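(* Let $\mathcal{B}$ be a unital $C^*$-algebra, let $n \geq 1$, and let $A = (A_0, A_1, \dots, A_n)$ be an $(n+1)$-tuple of elements of $\mathcal{B}$. Then every connected component of $P^c(A)$ is a domain of holomorphy in $\mathbb{C}^{n+1}$.
   Context: For $z = (z_0, \dots, z_n) \in \mathbb{C}^{n+1}$ put $A(z) = z_0A_0 + z_1A_1 + \cdots + z_nA_n \in \mathcal{B}$, $P(A) = \{z \in \mathbb{C}^{n+1} : A(z) \text{ is not invertible in } \mathcal{B}\}$, and $P^c(A) = \mathbb{C}^{n+1} \setminus P(A)$, which is an open subset of $\mathbb{C}^{n+1}$. The elements of the tuple are not assumed to commute. *)

theory Defs
  imports "HOL-Analysis.Analysis"
begin

section \<open>Unital C*-algebras\<close>

text \<open>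
  The real structure (norm, topology, completeness, unit of norm 1) comes from the library
  classes; \<open>scaleC_of_real\<close> says that the complex scalar multiplication extends the
  real one.
\<close>

class complex_banach_algebra_1 = real_normed_algebra_1 + banach +
  fixes scaleC :: "complex \<Rightarrow> 'a \<Rightarrow> 'a"  (infixr \<open>*\<^sub>C\<close> 75)
  assumes scaleC_of_real: "complex_of_real r *\<^sub>C x = r *\<^sub>R x"
    and scaleC_add_right: "c *\<^sub>C (x + y) = c *\<^sub>C x + c *\<^sub>C y"
    and scaleC_add_left: "(c + d) *\<^sub>C x = c *\<^sub>C x + d *\<^sub>C x"
    and scaleC_scaleC: "c *\<^sub>C (d *\<^sub>C x) = (c * d) *\<^sub>C x"
    and mult_scaleC_left: "(c *\<^sub>C x) * y = c *\<^sub>C (x * y)"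
    and mult_scaleC_right: "x * (c *\<^sub>C y) = c *\<^sub>C (x * y)"
    and norm_scaleC: "norm (c *\<^sub>C x) = cmod c * norm x"

class unital_cstar_algebra = complex_banach_algebra_1 +
  fixes star :: "'a \<Rightarrow> 'a"
  assumes star_star: "star (star x) = x"
    and star_add: "star (x + y) = star x + star y"
    and star_scaleC: "star (c *\<^sub>C x) = cnj c *\<^sub>C star x"
    and star_mult: "star (x * y) = star y * star x"
    and cstar_identity: "norm (star x * x) = (norm x)\<^sup>2"

instantiation complex :: unital_cstar_algebra
begin

definition scaleC_complex :: "complex \<Rightarrow> complex \<Rightarrow> complex"
  where "scaleC_complex c x = c * x"

definition star_complex :: "complex \<Rightarrow> complex"
  where "star_complex = cnj"

instance
  by standard
    (simp_all add: scaleC_complex_def star_complex_def scaleR_conv_of_real algebra_simps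
      norm_mult power2_eq_square)

end


section \<open>The projective spectrum\<close>

definition invertible_elem :: "'a::monoid_mult \<Rightarrow> bool"
  where "invertible_elem x \<longleftrightarrow> (\<exists>y. x * y = 1 \<and> y * x = 1)"

text \<open>
  An \<open>(n+1)\<close>-tuple is a vector indexed by a finite type \<open>'m\<close> with \<open>n + 1\<close> elements.
\<close>

definition linear_pencil :: "'b::complex_banach_algebra_1 ^ 'm \<Rightarrow> complex ^ 'm \<Rightarrow> 'b"
  where "linear_pencil A z = (\<Sum>i\<in>UNIV. (z $ i) *\<^sub>C (A $ i))"

definition proj_spectrum :: "'b::complex_banach_algebra_1 ^ 'm \<Rightarrow> (complex ^ 'm) set"
  where "proj_spectrum A = {z. \<not> invertible_elem (linear_pencil A z)}"

definition proj_resolvent :: "'b::complex_banach_algebra_1 ^ 'm \<Rightarrow> (complex ^ 'm) set"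
  where "proj_resolvent A = - proj_spectrum A"


section \<open>Domains of holomorphy\<close>

text \<open>
  Holomorphy in several variables: at each point of \<open>S\<close> (in practice an open set) the function
  is Frechet differentiable and its differential, a priori only real linear, is complex linear.
\<close>

definition holomorphic_several_on :: "(complex ^ 'm \<Rightarrow> complex) \<Rightarrow> (complex ^ 'm) set \<Rightarrow> bool"
  where "holomorphic_several_on f S \<longleftrightarrow>
    (\<forall>z\<in>S. \<exists>f'. (f has_derivative f') (at z) \<and> (\<forall>c v. f' (c *s v) = c * f' v))"

text \<open>
  The definition of Hoermander (An Introduction to Complex Analysis in Several Variables,
  Definition 2.5.1): there are no open \<open>V\<close>, \<open>W\<close> with \<open>V\<close> nonempty, \<open>V \<subseteq> W \<inter> D\<close>, and \<open>W\<close>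
  connected and not contained in \<open>D\<close>, such that every \<open>f\<close> holomorphic on \<open>D\<close> agrees on \<open>V\<close> with
  some \<open>g\<close> holomorphic on \<open>W\<close>. Equality is required on \<open>V\<close> only, since \<open>D \<inter> W\<close>
  may be disconnected.
\<close>

definition domain_of_holomorphy :: "(complex ^ 'm) set \<Rightarrow> bool"
  where "domain_of_holomorphy D \<longleftrightarrow>
    open D \<and> connected D \<and> D \<noteq> {} \<and>
    \<not> (\<exists>V W. open V \<and> open W \<and> V \<noteq> {} \<and> V \<subseteq> W \<inter> D \<and> connected W \<and> \<not> W \<subseteq> D \<and>
         (\<forall>f. holomorphic_several_on f D \<longrightarrow>
           (\<exists>g. holomorphic_several_on g W \<and> (\<forall>z\<in>V. f z = g z))))"

end

(* If every function on D continued to W, then in particular so would u \<circ> A(z)^(-1) for every bounded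
   functional u, and by the identity theorem the continuation would agree with it on a component U
   of W \<inter> D. As W is not contained in D, some p in W \<inter> closure U lies in the projective spectrum;
   for z_k \<rightarrow> p in U every u (A(z_k)^(-1)) converges, so by uniform boundedness A(z_k)^(-1) is bounded,
   which would make A(p) invertible. The functionals come from Hahn-Banach, proved here by
   taking a minimal sublinear functional, which is automatically linear. *)

theory Submission
  imports Defs "HOL-Complex_Analysis.Conformal_Mappings"
begin

section \<open>Hahn-Banach and uniform boundedness\<close>

definition sublinear :: "('a::real_vector \<Rightarrow> real) \<Rightarrow> bool"
  where "sublinear p \<longleftrightarrow> (\<forall>x y. p (x + y) \<le> p x + p y) \<and> (\<forall>c x. 0 \<le> c \<longrightarrow> p (c *\<^sub>R x) = c * p x)"

lemma sublinear_add: "sublinear p \<Longrightarrow> p (x + y) \<le> p x + p y"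
  by (simp add: sublinear_def)

lemma sublinear_scaleR: "sublinear p \<Longrightarrow> 0 \<le> c \<Longrightarrow> p (c *\<^sub>R x) = c * p x"
  by (simp add: sublinear_def)

lemma sublinear_zero: "sublinear p \<Longrightarrow> p 0 = 0"
  using sublinear_scaleR[of p 0 0] by simp

lemma sublinear_minus: "sublinear p \<Longrightarrow> - p (- x) \<le> p x"
  using sublinear_add[of p x "- x"] sublinear_zero[of p] by simp

lemma sublinear_norm: "sublinear norm"
  by (simp add: sublinear_def norm_triangle_ineq)

text \<open>Only one inequality is needed for positive scalars: the reverse one is the same
  inequality for \<open>inverse c\<close> at the point \<open>c *\<^sub>R x\<close>.\<close>

lemma sublinearI:
  assumes add: "\<And>x y. p (x + y) \<le> p x + p y"
    and scale: "\<And>c x. 0 < c \<Longrightarrow> p (c *\<^sub>R x) \<le> c * p x"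
    and zero: "p 0 = 0"
  shows "sublinear p"
  unfolding sublinear_def
proof (intro conjI allI impI add)
  fix c :: real and x assume "0 \<le> c"
  show "p (c *\<^sub>R x) = c * p x"
  proof (cases "c = 0")
    case False
    then have c: "c > 0" using \<open>0 \<le> c\<close> by simp
    have "p (inverse c *\<^sub>R c *\<^sub>R x) \<le> inverse c * p (c *\<^sub>R x)"
      using c by (intro scale) simp
    then have "c * p x \<le> p (c *\<^sub>R x)"
      using c by (simp add: field_simps)
    then show ?thesis using scale[OF c, of x] by simp
  qed (simp add: zero)
qed

text \<open>Applied to a minimal \<open>p\<close> this yields \<open>p (- y) = - p y\<close>, hence linearity; applied to the
  norm it yields norming functionals.\<close>

lemma sublinear_lower_at:
  assumes p: "sublinear p"
  obtains q where "sublinear q" "q \<le> p" "q (- y) \<le> - p y"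
proof -
  \<comment> \<open>The functional \<open>q\<close> is the infimum of \<open>h x t\<close> over
    \<open>t >= 0\<close>. Taking \<open>t = 0\<close> shows \<open>q <= p\<close>, and taking
    \<open>t = 1\<close> at \<open>- y\<close> shows \<open>q (- y) <= - p y\<close>.\<close>
  define h where "h x t = p (x + t *\<^sub>R y) - t * p y" for x t
  define q where "q x = (INF t\<in>{0..}. h x t)" for x
  \<comment> \<open>This bound keeps the infimum finite. It comes from splitting
    \<open>t *\<^sub>R y\<close> as \<open>(x + t *\<^sub>R y) + (- x)\<close>.\<close>
  have lb: "- p (- x) \<le> h x t" if "t \<ge> 0" for x t
    using sublinear_add[OF p, of "x + t *\<^sub>R y" "- x"] sublinear_scaleR[OF p that, of y]
    by (simp add: h_def)
  have bdd: "bdd_below (h x ` {0..})" for x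
    by (rule bdd_belowI2[of _ "- p (- x)"]) (simp add: lb)
  have le: "q x \<le> h x t" if "t \<ge> 0" for x t
    unfolding q_def using that by (intro cINF_lower bdd) auto
  have ge: "m \<le> q x" if "\<And>t. t \<ge> 0 \<Longrightarrow> m \<le> h x t" for m x
    unfolding q_def using that by (intro cINF_greatest) auto
  have "sublinear q"
  proof (rule sublinearI)
    fix x x'
    \<comment> \<open>The parameters of the two summands add up, and the infima over
      \<open>s\<close> and \<open>t\<close> are then taken one after the other.\<close>
    have *: "q (x + x') \<le> h x t + h x' s" if "t \<ge> 0" "s \<ge> 0" for t s
    proof -
      have "q (x + x') \<le> h (x + x') (t + s)" using that by (intro le) simp
      also have "\<dots> \<le> h x t + h x' s"
        using sublinear_add[OF p, of "x + t *\<^sub>R y" "x' + s *\<^sub>R y"]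
        by (simp add: h_def algebra_simps)
      finally show ?thesis .
    qed
    have "q (x + x') - h x t \<le> q x'" if "t \<ge> 0" for t
      by (rule ge) (use *[OF that] in \<open>simp add: algebra_simps\<close>)
    then have "q (x + x') - q x' \<le> q x"
      by (intro ge) (simp add: algebra_simps)
    then show "q (x + x') \<le> q x + q x'" by simp
  next
    fix c :: real and x assume c: "0 < c"
    have "q (c *\<^sub>R x) / c \<le> h x t" if "t \<ge> 0" for t
    proof -
      have "q (c *\<^sub>R x) \<le> h (c *\<^sub>R x) (c * t)" using that c by (intro le) simp
      also have "\<dots> = c * h x t"
        using sublinear_scaleR[OF p, of c "x + t *\<^sub>R y"] c
        by (simp add: h_def algebra_simps)
      finally show ?thesis using c by (simp add: field_simps)
    qed
    then have "q (c *\<^sub>R x) / c \<le> q x" by (rule ge)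
    then show "q (c *\<^sub>R x) \<le> c * q x" using c by (simp add: field_simps)
  next
    have "h 0 t = 0" if "t \<ge> 0" for t
      using sublinear_scaleR[OF p that, of y] by (simp add: h_def)
    then show "q 0 = 0" unfolding q_def by simp
  qed
  moreover have "q x \<le> p x" for x
    using le[of 0 x] by (simp add: h_def)
  then have "q \<le> p" by (rule le_funI)
  moreover have "q (- y) \<le> - p y"
    using le[of 1 "- y"] sublinear_zero[OF p] by (simp add: h_def)
  ultimately show ?thesis using that by blast
qed

text \<open>The pointwise infimum works: it is finite because all members lie above
  \<open>- p0 (- x)\<close>. The chain condition is what gives subadditivity, since
  \<open>p x + q y\<close> can be compared with a single \<open>r\<close> below both
  \<open>p\<close> and \<open>q\<close>.\<close>

lemma sublinear_Inf_chain:
  assumes C: "C \<noteq> {}" "\<And>p. p \<in> C \<Longrightarrow> sublinear p \<and> p \<le> p0"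
    and chain: "\<And>p q. p \<in> C \<Longrightarrow> q \<in> C \<Longrightarrow> p \<le> q \<or> q \<le> p"
  obtains m where "sublinear m" "\<And>p. p \<in> C \<Longrightarrow> m \<le> p"
proof -
  define m where "m x = (INF p\<in>C. p x)" for x
  have lb: "- p0 (- x) \<le> p x" if "p \<in> C" for p x
    using sublinear_minus[of p x] C(2)[OF that] le_funD[of p p0 "- x"] by force
  have le: "m x \<le> p x" if "p \<in> C" for p x
    unfolding m_def using that
    by (intro cINF_lower bdd_belowI2[of _ "- p0 (- x)"]) (simp_all add: lb)
  have ge: "a \<le> m x" if "\<And>p. p \<in> C \<Longrightarrow> a \<le> p x" for a x
    unfolding m_def using that C(1) by (intro cINF_greatest) auto
  have "sublinear m"
  proof (rule sublinearI)
    fix x y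
    have *: "m (x + y) \<le> p x + q y" if pq: "p \<in> C" "q \<in> C" for p q
    proof -
      obtain r where r: "r \<in> C" "r \<le> p" "r \<le> q" using chain pq by blast
      have "m (x + y) \<le> r (x + y)" by (rule le[OF r(1)])
      also have "\<dots> \<le> r x + r y" using C(2)[OF r(1)] by (simp add: sublinear_add)
      also have "\<dots> \<le> p x + q y" using r by (intro add_mono) (auto dest: le_funD)
      finally show ?thesis .
    qed
    have "m (x + y) - p x \<le> m y" if "p \<in> C" for p
      by (rule ge) (use *[OF that] in \<open>simp add: algebra_simps\<close>)
    then have "m (x + y) - m y \<le> m x"
      by (intro ge) (simp add: algebra_simps)
    then show "m (x + y) \<le> m x + m y" by simp
  next
    fix c :: real and x assume c: "0 < c"
    have "m (c *\<^sub>R x) / c \<le> p x" if "p \<in> C" for p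
      using le[OF that, of "c *\<^sub>R x"] sublinear_scaleR[of p c x] C(2)[OF that] c
      by (simp add: field_simps)
    then have "m (c *\<^sub>R x) / c \<le> m x" by (rule ge)
    then show "m (c *\<^sub>R x) \<le> c * m x" using c by (simp add: field_simps)
  next
    have "p 0 = 0" if "p \<in> C" for p using C(2)[OF that] by (simp add: sublinear_zero)
    then have "(\<lambda>p. p 0) ` C = {0}" using C(1) by force
    then show "m 0 = 0" unfolding m_def by simp
  qed
  then show ?thesis using that le by (meson le_funI)
qed

text \<open>Minimality forces the \<open>q\<close> of \<open>sublinear_lower_at\<close> to equal
  \<open>p\<close>, so \<open>p\<close> is odd. Subadditivity at \<open>- x\<close> and
  \<open>- y\<close> then becomes superadditivity at \<open>x\<close> and \<open>y\<close>.\<close>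

lemma linear_if_minimal_sublinear:
  assumes p: "sublinear p" and minimal: "\<And>q. sublinear q \<Longrightarrow> q \<le> p \<Longrightarrow> q = p"
  shows "linear p"
proof -
  have neg: "p (- y) = - p y" for y
  proof -
    obtain q where q: "sublinear q" "q \<le> p" "q (- y) \<le> - p y"
      using sublinear_lower_at[OF p] by blast
    have "q = p" using minimal q by blast
    then show ?thesis using q(3) sublinear_minus[OF p, of y] by simp
  qed
  show ?thesis
  proof (rule linearI)
    fix x y
    show "p (x + y) = p x + p y"
      using sublinear_add[OF p, of x y] sublinear_add[OF p, of "- x" "- y"] neg[of "x + y"] neg
      by simp
  next
    fix c :: real and x
    show "p (c *\<^sub>R x) = c *\<^sub>R p x"
    proof (cases "c \<ge> 0")
      case False
      then show ?thesis
        using sublinear_scaleR[OF p, of "- c" x] neg[of "c *\<^sub>R x"] by simp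
    qed (simp add: sublinear_scaleR[OF p])
  qed
qed

text \<open>Zorn's lemma for the reversed pointwise order, so that maximal elements are minimal
  functionals. The empty chain is bounded by \<open>p0\<close> itself.\<close>

lemma linear_below_sublinear:
  assumes "sublinear p0"
  obtains f where "linear f" "f \<le> p0"
proof -
  let ?A = "{p. sublinear p \<and> p \<le> p0}"
  have "\<exists>m\<in>?A. \<forall>a\<in>?A. a \<le> m \<longrightarrow> a = m"
  proof (rule predicate_Zorn)
    show "partial_order_on ?A (relation_of (\<lambda>p q. q \<le> p) ?A)"
      by (rule partial_order_on_relation_ofI) auto
  next
    fix C assume C: "C \<in> Chains (relation_of (\<lambda>p q. q \<le> p) ?A)"
    show "\<exists>u\<in>?A. \<forall>a\<in>C. u \<le> a"
    proof (cases "C = {}")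
      case True
      then show ?thesis using assms by auto
    next
      case False
      have mem: "sublinear p \<and> p \<le> p0" if "p \<in> C" for p
        using C that unfolding Chains_def relation_of_def by auto
      have tot: "p \<le> q \<or> q \<le> p" if "p \<in> C" "q \<in> C" for p q
        using C that unfolding Chains_def relation_of_def by blast
      obtain m where m: "sublinear m" "\<And>p. p \<in> C \<Longrightarrow> m \<le> p"
        using sublinear_Inf_chain[OF False mem tot] by blast
      moreover have "m \<le> p0" using False m(2) mem by (meson ex_in_conv order_trans)
      ultimately show ?thesis by blast
    qed
  qed
  then obtain m where m: "sublinear m" "m \<le> p0" "\<And>a. sublinear a \<Longrightarrow> a \<le> p0 \<Longrightarrow> a \<le> m \<Longrightarrow> a = m"
    by blast
  \<comment> \<open>A sublinear functional below \<open>m\<close> is also below \<open>p0\<close>,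
    so minimality within the family is minimality among all sublinear functionals.\<close>
  have "linear m" by (rule linear_if_minimal_sublinear) (use m order_trans in blast)+
  then show ?thesis using that m by blast
qed

text \<open>A linear \<open>f\<close> below the \<open>q\<close> that
  \<open>sublinear_lower_at\<close> makes from the norm has \<open>f (- x) <= - norm x\<close>,
  hence \<open>f x >= norm x\<close>. Being below the norm at \<open>y\<close> and
  \<open>- y\<close> gives the opposite bound and operator norm at most 1.\<close>

lemma norming_functional:
  fixes x :: "'a::real_normed_vector"
  obtains u :: "'a \<Rightarrow>\<^sub>L real" where "norm u \<le> 1" "u x = norm x"
proof -
  obtain q :: "'a \<Rightarrow> real" where q: "sublinear q" "q \<le> norm" "q (- x) \<le> - norm x"
    using sublinear_lower_at[OF sublinear_norm] by blast
  obtain f where f: "linear f" "f \<le> q" using linear_below_sublinear[OF q(1)] by blast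
  have le: "f y \<le> norm y" for y using f(2) q(2) by (meson le_funD order_trans)
  have bd: "\<bar>f y\<bar> \<le> norm y" for y
    using le[of y] le[of "- y"] linear_neg[OF f(1), of y] by simp
  have "bounded_linear f"
    by (rule bounded_linear_intro[of _ 1]) (use f(1) bd in \<open>auto simp: linear_add linear_scale\<close>)
  then have u: "blinfun_apply (Blinfun f) = f" by (rule bounded_linear_Blinfun_apply)
  have "norm (Blinfun f) \<le> 1"
    by (rule norm_blinfun_bound) (simp_all add: u bd)
  moreover have "f (- x) \<le> - norm x" using f(2) q(3) by (meson le_funD order_trans)
  then have "f x = norm x" using le[of x] linear_neg[OF f(1), of x] by simp
  ultimately show ?thesis using that u by metis
qed

section \<open>Uniform boundedness by Baire category\<close>

text \<open>The points of \<open>S\<close> act as functionals on the dual, which is complete even if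
  \<open>'a\<close> is not. Baire gives a ball of functionals bounded uniformly on \<open>S\<close>,
  and norming functionals turn this into a bound on the norms.\<close>

lemma bounded_if_weakly_bounded:
  fixes S :: "'a::real_normed_vector set"
  assumes "\<And>u :: 'a \<Rightarrow>\<^sub>L real. bounded (u ` S)"
  shows "bounded S"
proof -
  define F where "F n = {u :: 'a \<Rightarrow>\<^sub>L real. \<forall>x\<in>S. \<bar>u x\<bar> \<le> real n}" for n
  have "closed (F n)" for n
  proof -
    have "F n = (\<Inter>x\<in>S. {u. \<bar>blinfun_apply u x\<bar> \<le> real n})" by (auto simp: F_def)
    moreover have "closed {u. \<bar>blinfun_apply u x\<bar> \<le> real n}" for x :: 'a
      by (intro closed_Collect_le continuous_intros)
    ultimately show ?thesis by auto
  qed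
  moreover have "(\<Union>n. F n) = UNIV"
  proof -
    have "\<exists>n. u \<in> F n" for u
    proof -
      obtain B where "\<And>x. x \<in> S \<Longrightarrow> \<bar>u x\<bar> \<le> B"
        using assms[of u] unfolding bounded_iff by auto
      moreover obtain n where "B \<le> real n" using real_arch_simple by blast
      ultimately show ?thesis unfolding F_def by (blast intro: order_trans)
    qed
    then show ?thesis by blast
  qed
  ultimately have "\<exists>n. interior (F n) \<noteq> {}"
    using Met_TC.metric_Baire_category_alt[where ?'a = "'a \<Rightarrow>\<^sub>L real", of "range F"] complete_UNIV
    by (auto simp: closedin_def)
  then obtain n v r where r: "r > 0" "ball v r \<subseteq> F n"
    by (meson ex_in_conv mem_interior)
  have "norm x \<le> 4 * real n / r" if x: "x \<in> S" for x
  proof -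
    obtain u :: "'a \<Rightarrow>\<^sub>L real" where u: "norm u \<le> 1" "u x = norm x" by (rule norming_functional)
    \<comment> \<open>The factor \<open>r/2\<close> keeps the shifted functional strictly inside the
      ball. Subtracting the bounds at the shifted functional and at the centre leaves
      \<open>r/2 * norm x <= 2 * n\<close>.\<close>
    have "norm ((r/2) *\<^sub>R u) < r"
      using u(1) r(1) mult_left_le[of "norm u" "r/2"] by simp
    then have "v + (r/2) *\<^sub>R u \<in> F n" "v \<in> F n"
      using r by (auto simp: dist_norm intro!: subsetD[OF r(2)])
    then have "\<bar>v x + r/2 * norm x\<bar> \<le> n" "\<bar>v x\<bar> \<le> n"
      using x u(2) unfolding F_def by (auto simp: blinfun.bilinear_simps)
    then have "r/2 * norm x \<le> 2 * real n" by linarith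
    then show ?thesis using r(1) by (simp add: field_simps)
  qed
  then show ?thesis unfolding bounded_iff by blast
qed
section \<open>Inversion in a Banach algebra\<close>

text \<open>Neumann series: the sum \<open>y\<close> of the powers of \<open>x\<close> satisfies
  \<open>x * y = y * x = y - 1\<close>.\<close>

lemma invertible_elem_one_minus:
  fixes x :: "'a::{real_normed_algebra_1,banach}"
  assumes "norm x < 1"
  shows "invertible_elem (1 - x)"
proof -
  have "summable (\<lambda>n. norm x ^ n)" using assms by simp
  then have s: "summable (\<lambda>n. x ^ n)"
    by (rule summable_comparison_test'[of _ 0]) (rule norm_power_ineq)
  let ?y = "\<Sum>n. x ^ n"
  have "(\<Sum>n. x ^ Suc n) = ?y - 1"
    using suminf_split_head[OF s] by simp
  then have "x * ?y = ?y - 1" "?y * x = ?y - 1"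
    using suminf_mult[OF s, of x] suminf_mult2[OF s, of x] by (simp_all add: power_commutes)
  then have "(1 - x) * ?y = 1" "?y * (1 - x) = 1"
    by (simp_all only: left_diff_distrib right_diff_distrib mult_1_left mult_1_right) simp_all
  then show ?thesis unfolding invertible_elem_def by blast
qed

lemma invertible_elem_mult:
  "invertible_elem x \<Longrightarrow> invertible_elem y \<Longrightarrow> invertible_elem (x * y)"
  unfolding invertible_elem_def by (metis mult.assoc mult_1_left)

definition inv_elem :: "'a::monoid_mult \<Rightarrow> 'a"
  where "inv_elem x = (SOME y. x * y = 1 \<and> y * x = 1)"

lemma inv_elem:
  assumes "invertible_elem x"
  shows "x * inv_elem x = 1" "inv_elem x * x = 1"
proof -
  have "x * inv_elem x = 1 \<and> inv_elem x * x = 1"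
    unfolding inv_elem_def using assms unfolding invertible_elem_def by (rule someI_ex)
  then show "x * inv_elem x = 1" "inv_elem x * x = 1" by auto
qed

text \<open>The resolvent identity, in both orders because \<open>x\<close> and \<open>y\<close>
  need not commute.\<close>

lemma inv_elem_diff:
  fixes x y :: "'a::ring_1"
  assumes "invertible_elem x" "invertible_elem y"
  shows "inv_elem y - inv_elem x = - (inv_elem y * (y - x) * inv_elem x)"
    and "inv_elem y - inv_elem x = - (inv_elem x * (y - x) * inv_elem y)"
  using inv_elem[OF assms(1)] inv_elem[OF assms(2)]
  by (simp_all add: algebra_simps mult.assoc)

text \<open>Factor \<open>y\<close> as \<open>x\<close> times
  \<open>1 - inv_elem x * (x - y)\<close> and apply the Neumann series to the second factor.\<close>

lemma invertible_elem_perturb: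
  fixes x y :: "'a::{real_normed_algebra_1,banach}"
  assumes x: "invertible_elem x" and less: "norm (inv_elem x) * norm (y - x) < 1"
  shows "invertible_elem y"
proof -
  have "norm (inv_elem x * (x - y)) < 1"
    using norm_mult_ineq[of "inv_elem x" "x - y"] less by (simp add: norm_minus_commute)
  then have "invertible_elem (x * (1 - inv_elem x * (x - y)))"
    by (intro invertible_elem_mult x invertible_elem_one_minus)
  also have "x * (1 - inv_elem x * (x - y)) = y"
    using inv_elem(1)[OF x] by (simp add: right_diff_distrib flip: mult.assoc)
  finally show ?thesis .
qed

lemma open_invertible_elem: "open {x :: 'a::{real_normed_algebra_1,banach}. invertible_elem x}"
  unfolding open_dist
proof clarify
  fix x :: 'a assume x: "invertible_elem x"
  have pos: "norm (inv_elem x) > 0" using inv_elem(1)[OF x] by auto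
  show "\<exists>e>0. \<forall>y. dist y x < e \<longrightarrow> y \<in> {x. invertible_elem x}"
    using pos invertible_elem_perturb[OF x]
    by (intro exI[of _ "1 / norm (inv_elem x)"]) (simp add: dist_norm field_simps)
qed

text \<open>With \<open>b\<close>, \<open>c\<close> the inverses of \<open>x\<close>,
  \<open>y\<close> and \<open>h = y - x\<close>, two uses of the resolvent identity give the
  remainder \<open>b * h * c * h * b\<close>, which is quadratic in \<open>h\<close> once
  \<open>c\<close> is bounded near \<open>x\<close>.\<close>

lemma has_derivative_inv_elem:
  fixes x :: "'a::{real_normed_algebra_1,banach}"
  assumes x: "invertible_elem x"
  shows "(inv_elem has_derivative (\<lambda>h. - (inv_elem x * h * inv_elem x))) (at x)"
proof -
  let ?b = "inv_elem x"
  have pos: "norm ?b > 0" using inv_elem(1)[OF x] by auto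
  let ?e = "1 / (2 * norm ?b)"
  show ?thesis
  proof (rule has_derivativeI_sandwich[of ?e _ _ _ _ "\<lambda>y. 2 * norm ?b ^ 3 * norm (y - x)"])
    show "0 < ?e" using pos by simp
    show "bounded_linear (\<lambda>h. - (?b * h * ?b))" 
      by (intro bounded_linear_minus bounded_linear_compose[OF bounded_linear_mult_left]
          bounded_linear_mult_right)
    have "((\<lambda>y. 2 * norm ?b ^ 3 * norm (y - x)) \<longlongrightarrow> 2 * norm ?b ^ 3 * norm (x - x)) (at x)"
      by (intro tendsto_intros)
    then show "((\<lambda>y. 2 * norm ?b ^ 3 * norm (y - x)) \<longlongrightarrow> 0) (at x)" by simp
    fix y assume y: "y \<noteq> x" "dist y x < ?e"
    let ?h = "y - x" and ?c = "inv_elem y"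
    \<comment> \<open>The choice of \<open>?e\<close> pays twice: \<open>y\<close> is invertible,
      and the term \<open>norm ?c * (1/2)\<close> below can be absorbed on the left to give
      \<open>norm ?c <= 2 * norm ?b\<close>.\<close>
    have small: "norm ?b * norm ?h \<le> 1/2"
      using y(2) pos by (simp add: dist_norm field_simps)
    have inv: "invertible_elem y" by (rule invertible_elem_perturb[OF x]) (use small in simp)
    have nrm: "norm (p * q * r) \<le> norm p * norm q * norm r" for p q r :: 'a
      by (meson mult_right_mono norm_ge_zero norm_mult_ineq order_trans)
    have "norm (?c - ?b) = norm (?c * ?h * ?b)"
      unfolding inv_elem_diff(1)[OF x inv] by simp
    then have "norm ?c \<le> norm ?b + norm (?c * ?h * ?b)"
      using norm_triangle_sub[of ?c ?b] by simp
    also have "norm (?c * ?h * ?b) \<le> norm ?c * (norm ?b * norm ?h)"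
      using nrm[of ?c ?h ?b] by (simp add: mult_ac)
    also have "\<dots> \<le> norm ?c * (1/2)" using small by (intro mult_left_mono) auto
    finally have c: "norm ?c \<le> 2 * norm ?b" by simp
    have "?c - ?b - - (?b * ?h * ?b) = - ((?c - ?b) * ?h * ?b)"
      using inv_elem_diff(1)[OF x inv] by (simp add: algebra_simps)
    also have "\<dots> = ?b * ?h * ?c * ?h * ?b"
      unfolding inv_elem_diff(2)[OF x inv] by (simp add: mult.assoc)
    finally have "norm (?c - ?b - - (?b * ?h * ?b)) = norm (?b * ?h * ?c * (?h * ?b))"
      by (simp add: mult.assoc)
    also have "\<dots> \<le> norm (?b * ?h * ?c) * norm (?h * ?b)" by (rule norm_mult_ineq)
    also have "\<dots> \<le> (norm ?b * norm ?h * norm ?c) * (norm ?h * norm ?b)"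
      by (intro mult_mono nrm norm_mult_ineq) auto
    also have "\<dots> \<le> (norm ?b * norm ?h * (2 * norm ?b)) * (norm ?h * norm ?b)"
      by (intro mult_right_mono mult_left_mono c) auto
    also have "\<dots> = 2 * norm ?b ^ 3 * norm ?h * norm ?h"
      by (simp add: power3_eq_cube)
    finally show "norm (?c - ?b - - (?b * ?h * ?b)) / norm ?h \<le> 2 * norm ?b ^ 3 * norm ?h"
      using y(1) by (simp add: divide_le_eq)
  qed
qed

text \<open>A common bound \<open>M\<close> on the inverses would make everything within
  \<open>1 / M\<close> of any \<open>x k\<close> invertible, and \<open>a\<close> is that close to
  some \<open>x k\<close>.\<close>

lemma not_bounded_inv_elem:
  fixes x :: "nat \<Rightarrow> 'a::{real_normed_algebra_1,banach}"
  assumes lim: "x \<longlonglongrightarrow> a" and inv: "\<And>k. invertible_elem (x k)" and a: "\<not> invertible_elem a"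
  shows "\<not> bounded (range (\<lambda>k. inv_elem (x k)))"
proof
  assume "bounded (range (\<lambda>k. inv_elem (x k)))"
  then obtain M where M: "M > 0" "\<And>k. norm (inv_elem (x k)) \<le> M"
    unfolding bounded_pos by blast
  obtain k where "norm (x k - a) < 1 / M"
    using LIMSEQ_D[OF lim, of "1 / M"] M(1) by auto
  then have "M * norm (a - x k) < 1" using M(1) by (simp add: field_simps norm_minus_commute)
  then have "norm (inv_elem (x k)) * norm (a - x k) < 1"
    using M(2)[of k] by (meson le_less_trans mult_right_mono norm_ge_zero)
  then show False using invertible_elem_perturb[OF inv] a by blast
qed

section \<open>The pencil and its resolvent set\<close>

lemma scaleR_scaleC: "r *\<^sub>R x = complex_of_real r *\<^sub>C x"
  for x :: "'a::complex_banach_algebra_1"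
  by (simp add: scaleC_of_real)

lemma bounded_linear_scaleC_left: "bounded_linear (\<lambda>c. c *\<^sub>C x)"
  for x :: "'a::complex_banach_algebra_1"
  by (rule bounded_linear_intro[of _ "norm x"])
     (simp_all add: scaleC_add_left norm_scaleC scaleR_scaleC scaleC_scaleC scaleC_complex_def)

lemma bounded_linear_scaleC_right: "bounded_linear (\<lambda>x :: 'a::complex_banach_algebra_1. c *\<^sub>C x)"
  by (rule bounded_linear_intro[of _ "cmod c"])
     (simp_all add: scaleC_add_right norm_scaleC scaleR_scaleC scaleC_scaleC mult.commute)

lemma bounded_linear_linear_pencil: "bounded_linear (linear_pencil A)"
  unfolding linear_pencil_def
  by (intro bounded_linear_sum bounded_linear_compose[OF bounded_linear_scaleC_left] bounded_linear_vec_nth)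

lemma linear_pencil_scale: "linear_pencil A (c *s z) = c *\<^sub>C linear_pencil A z"
  unfolding linear_pencil_def
  by (simp add: linear_sum[OF bounded_linear.linear[OF bounded_linear_scaleC_right]] scaleC_scaleC)

lemma proj_resolvent_iff: "z \<in> proj_resolvent A \<longleftrightarrow> invertible_elem (linear_pencil A z)"
  by (simp add: proj_resolvent_def proj_spectrum_def)

lemma open_proj_resolvent: "open (proj_resolvent A)"
proof -
  have "proj_resolvent A = linear_pencil A -` {x. invertible_elem x}"
    by (auto simp: proj_resolvent_iff)
  then show ?thesis
    using continuous_open_vimage[OF open_invertible_elem]
      linear_continuous_on[OF bounded_linear_linear_pencil]
    by (metis continuous_on_eq_continuous_at open_UNIV UNIV_I)
qed

section \<open>Holomorphy in several variables\<close>

lemma holomorphic_several_on_subset: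
  "holomorphic_several_on f S \<Longrightarrow> T \<subseteq> S \<Longrightarrow> holomorphic_several_on f T"
  unfolding holomorphic_several_on_def by blast

lemma holomorphic_several_on_diff:
  assumes "holomorphic_several_on f S" "holomorphic_several_on g S"
  shows "holomorphic_several_on (\<lambda>z. f z - g z) S"
  unfolding holomorphic_several_on_def
proof
  fix z assume "z \<in> S"
  then obtain f' g' where "(f has_derivative f') (at z)" "\<And>c v. f' (c *s v) = c * f' v"
    "(g has_derivative g') (at z)" "\<And>c v. g' (c *s v) = c * g' v"
    using assms unfolding holomorphic_several_on_def by meson
  then show "\<exists>d. ((\<lambda>z. f z - g z) has_derivative d) (at z) \<and> (\<forall>c v. d (c *s v) = c * d v)"
    by (intro exI[of _ "\<lambda>v. f' v - g' v"]) (auto intro: has_derivative_diff simp: algebra_simps)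
qed

lemma holomorphic_several_on_isCont:
  "holomorphic_several_on f S \<Longrightarrow> z \<in> S \<Longrightarrow> isCont f z"
  unfolding holomorphic_several_on_def by (meson has_derivative_continuous)

lemma bounded_linear_vector_scalar_mult_left: "bounded_linear (\<lambda>c :: complex. c *s (v :: complex ^ 'm))"
  by (intro linear_conv_bounded_linear[THEN iffD1] linearI) (auto simp: vec_eq_iff algebra_simps)

text \<open>Complex linearity of \<open>f'\<close> turns the real derivative along the line into
  multiplication by the number \<open>f' v\<close>.\<close>

lemma holomorphic_on_line:
  fixes q v :: "complex ^ 'm"
  assumes "holomorphic_several_on f S" and line: "\<And>c. c \<in> T \<Longrightarrow> q + c *s v \<in> S"
  shows "(\<lambda>c. f (q + c *s v)) holomorphic_on T"
proof (rule holomorphic_onI)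
  fix c assume "c \<in> T"
  then obtain f' where f': "(f has_derivative f') (at (q + c *s v))" "\<And>c v. f' (c *s v) = c * f' v"
    using assms unfolding holomorphic_several_on_def by blast
  have "((\<lambda>c. q + c *s v) has_derivative (\<lambda>c. c *s v)) (at c)"
    using has_derivative_add[OF has_derivative_const
        bounded_linear_imp_has_derivative[OF bounded_linear_vector_scalar_mult_left]] by simp
  then have "((\<lambda>c. f (q + c *s v)) has_derivative (\<lambda>c. f' (c *s v))) (at c)"
    using has_derivative_compose f'(1) by blast
  then have "((\<lambda>c. f (q + c *s v)) has_field_derivative f' v) (at c)"
    unfolding has_field_derivative_def f'(2) by (simp add: mult.commute[of _ "f' v"])
  then show "(\<lambda>c. f (q + c *s v)) field_differentiable at c within T"
    using field_differentiable_at_within field_differentiable_def by blast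
qed

lemma norm_vector_scalar_mult: "norm (c *s v) = cmod c * norm v" for v :: "complex ^ 'm"
  by (simp add: norm_vec_def L2_set_right_distrib norm_mult)

section \<open>The identity theorem in several variables\<close>

text \<open>Restriction to the complex line through \<open>q\<close> and \<open>z\<close> reduces to
  one variable: the parameter disc has radius \<open>?R > 1\<close>, the function vanishes near
  parameter 0, and parameter 1 is \<open>z\<close>.\<close>

lemma holomorphic_several_zero_on_ball:
  fixes q :: "complex ^ 'm"
  assumes hol: "holomorphic_several_on f (ball q r)"
    and q: "q \<in> interior {z. f z = 0}" and z: "z \<in> ball q r"
  shows "f z = 0"
proof (cases "z = q")
  case True
  then show ?thesis using q interior_subset by blast
next
  case False
  let ?v = "z - q"
  let ?R = "r / norm ?v"
  have nz: "norm ?v > 0" using False by simp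
  have in_ball: "q + c *s ?v \<in> ball q r" if "c \<in> ball 0 ?R" for c
  proof -
    have "dist q (q + c *s ?v) = cmod c * norm ?v"
      by (simp add: dist_norm norm_vector_scalar_mult del: vector_ssub_ldistrib)
    then show ?thesis using that nz by (simp add: field_simps)
  qed
  have hol1: "(\<lambda>c. f (q + c *s ?v)) holomorphic_on ball 0 ?R"
    by (rule holomorphic_on_line[OF hol]) (rule in_ball)
  have "continuous_on UNIV (\<lambda>c. q + c *s ?v)"
    by (intro continuous_on_add continuous_on_const linear_continuous_on
        bounded_linear_vector_scalar_mult_left)
  then have opn: "open ((\<lambda>c. q + c *s ?v) -` interior {z. f z = 0})" (is "open ?N")
    by (intro open_vimage) auto
  have R: "1 < ?R" using z nz by (simp add: dist_norm norm_minus_commute)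
  have "0 \<in> ?N \<inter> ball 0 ?R" using q R by auto
  then have "0 islimpt ?N \<inter> ball 0 ?R"
    using opn interior_limit_point[of 0 "?N \<inter> ball 0 ?R"] by (simp add: interior_open open_Int)
  then have "f (q + 1 *s ?v) = 0"
    by (rule analytic_continuation[OF hol1 open_ball connected_ball _ _ _ _ , rotated 2])
       (use R interior_subset in force)+
  then show ?thesis by simp
qed

text \<open>The set \<open>?E\<close> of points near which \<open>f\<close> and \<open>g\<close>
  agree is nonempty, open and closed in the connected set \<open>U\<close>.\<close>

lemma holomorphic_several_identity:
  fixes f g :: "complex ^ 'm \<Rightarrow> complex"
  assumes f: "holomorphic_several_on f U" and g: "holomorphic_several_on g U"
    and U: "open U" "connected U"
    and V: "open V" "V \<noteq> {}" "V \<subseteq> U" "\<And>z. z \<in> V \<Longrightarrow> f z = g z"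
    and z: "z \<in> U"
  shows "f z = g z"
proof -
  let ?h = "\<lambda>z. f z - g z"
  have hol: "holomorphic_several_on ?h U" by (rule holomorphic_several_on_diff[OF f g])
  let ?E = "U \<inter> interior {z. ?h z = 0}"
  have "closedin (top_of_set U) ?E"
    unfolding closedin_limpt
  proof (intro conjI allI impI)
    fix p assume p: "p islimpt ?E \<and> p \<in> U"
    then obtain r where r: "r > 0" "ball p r \<subseteq> U"
      using U(1) open_contains_ball by blast
    \<comment> \<open>Distance below \<open>r / 2\<close> makes the ball of radius
      \<open>r / 2\<close> about \<open>q\<close> contain \<open>p\<close> while staying inside
      \<open>ball p r\<close>.\<close>
    obtain q where q: "q \<in> ?E" "dist q p < r / 2"
      using p r(1) islimpt_approachable[of p ?E] by (meson half_gt_zero)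
    have sub: "ball q (r / 2) \<subseteq> ball p r"
    proof
      fix y assume "y \<in> ball q (r / 2)"
      then show "y \<in> ball p r"
        using q(2) dist_triangle[of p y q] by (simp add: dist_commute)
    qed
    have "?h y = 0" if "y \<in> ball q (r / 2)" for y
      by (rule holomorphic_several_zero_on_ball[OF _ _ that])
         (use q sub r holomorphic_several_on_subset[OF hol] in blast)+
    then have "ball q (r / 2) \<subseteq> interior {z. ?h z = 0}" by (intro interior_maximal) auto
    then show "p \<in> ?E" using p q(2) by auto
  qed auto
  moreover have "openin (top_of_set U) ?E" by (simp add: openin_open_Int)
  moreover have "V \<subseteq> interior {z. ?h z = 0}" using V by (intro interior_maximal) auto
  then have "V \<subseteq> ?E" using V(3) by blast
  ultimately have "?E = U" using U(2) V(2) unfolding connected_clopen by blast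
  then show ?thesis using z interior_subset by fastforce
qed

section \<open>Continuation of the resolvent\<close>

text \<open>The functionals obtained above are only real linear, so \<open>u\<close> is
  complexified. The derivative of inversion and the linearity of the pencil then make the
  differential complex linear.\<close>

lemma holomorphic_several_functional_resolvent:
  fixes A :: "'b::complex_banach_algebra_1 ^ 'm" and u :: "'b \<Rightarrow>\<^sub>L real"
  shows "holomorphic_several_on
    (\<lambda>z. Complex (u (inv_elem (linear_pencil A z))) (- u (\<i> *\<^sub>C inv_elem (linear_pencil A z))))
    (proj_resolvent A)"
  unfolding holomorphic_several_on_def
proof
  \<comment> \<open>The complex-linear functional with real part \<open>u\<close>\<close>
  define \<phi> where "\<phi> x = Complex (u x) (- u (\<i> *\<^sub>C x))" for x
  have "bounded_linear (\<lambda>x. complex_of_real (u x) + \<i> * complex_of_real (- u (\<i> *\<^sub>C x)))"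
    by (intro bounded_linear_add bounded_linear_compose[OF bounded_linear_mult_right]
        bounded_linear_compose[OF bounded_linear_of_real] bounded_linear_minus
        bounded_linear_compose[OF blinfun.bounded_linear_right] bounded_linear_scaleC_right
        blinfun.bounded_linear_right)
  then have bl: "bounded_linear \<phi>" by (simp add: \<phi>_def[abs_def] Complex_eq)
  have clin: "\<phi> (c *\<^sub>C x) = c * \<phi> x" for c x
  proof -
    have "c *\<^sub>C x = Re c *\<^sub>R x + Im c *\<^sub>R (\<i> *\<^sub>C x)"
      by (simp add: scaleR_scaleC scaleC_scaleC mult.commute flip: scaleC_add_left complex_eq)
    moreover have "\<phi> (\<i> *\<^sub>C x) = \<i> * \<phi> x"
      using scaleC_of_real[of "-1" x] 
      by (simp add: \<phi>_def complex_eq_iff scaleC_scaleC blinfun.minus_right)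
    ultimately have "\<phi> (c *\<^sub>C x) = Re c *\<^sub>R \<phi> x + Im c *\<^sub>R (\<i> * \<phi> x)"
      using bl by (simp add: linear_simps)
    then show ?thesis by (simp add: complex_eq_iff)
  qed
  fix z assume "z \<in> proj_resolvent A"
  then have inv: "invertible_elem (linear_pencil A z)" by (simp add: proj_resolvent_iff)
  let ?b = "inv_elem (linear_pencil A z)"
  have "((\<lambda>z. \<phi> (inv_elem (linear_pencil A z))) has_derivative
      (\<lambda>v. \<phi> (- (?b * linear_pencil A v * ?b)))) (at z)"
    by (intro bounded_linear.has_derivative[OF bl]
        has_derivative_compose[where f = "linear_pencil A", OF _ has_derivative_inv_elem[OF inv]]
        bounded_linear_imp_has_derivative bounded_linear_linear_pencil)
  moreover have "\<phi> (- (?b * linear_pencil A (c *s v) * ?b)) = c * \<phi> (- (?b * linear_pencil A v * ?b))" for c v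
    using bl by (simp add: linear_pencil_scale mult_scaleC_left mult_scaleC_right clin linear_simps)
  ultimately show "\<exists>f'. ((\<lambda>z. Complex (u (inv_elem (linear_pencil A z)))
        (- u (\<i> *\<^sub>C inv_elem (linear_pencil A z)))) has_derivative f') (at z) \<and>
      (\<forall>c v. f' (c *s v) = c * f' v)"
    unfolding \<phi>_def by blast
qed

text \<open>\<open>U\<close> is open, nonempty and not all of the connected set \<open>W\<close>, so
  it is not closed in \<open>W\<close> and has a limit point \<open>p\<close> in
  \<open>W - U\<close>. If \<open>p\<close> were in \<open>P\<close>, relative closedness of
  components would put it first in \<open>D\<close> and then in \<open>U\<close>.\<close>

lemma component_Int_boundary_point:
  fixes P :: "'a::real_normed_vector set"
  assumes P: "open P" and D: "D \<in> components P" and W: "open W" "connected W" "\<not> W \<subseteq> D"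
    and U: "U \<in> components (W \<inter> D)"
  obtains p where "p \<in> W" "p \<in> closure U" "p \<notin> P"
proof -
  have opU: "open U" using U P D W(1) open_components by blast
  have sub: "U \<noteq> {}" "U \<subseteq> W" "U \<subseteq> D"
    using U in_components_nonempty in_components_subset by blast+
  have "\<not> closedin (top_of_set W) U"
    using W sub opU unfolding connected_clopen by (metis inf.absorb_iff2 openin_open)
  then obtain p where p: "p \<in> W" "p \<in> closure U" "p \<notin> U"
    using sub(2) by (metis closedin_limpt closure_def UnI2 mem_Collect_eq)
  have closed_in: "x \<in> C" if "C \<in> components S" "x \<in> closure C" "x \<in> S" for x C and S :: "'a set"
    using closedin_component[OF that(1)] that(2,3) by (metis closedin_closed_eq closure_of_subset_eq
      closedin_closed Int_iff closure_minimal inf_le2 subsetD)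
  have "p \<notin> P"
  proof
    assume "p \<in> P"
    then have "p \<in> D" using closed_in[OF D] p(2) sub(3) closure_mono by blast
    then show False using closed_in[OF U p(2)] p by blast
  qed
  then show ?thesis using that p by blast
qed

theorem theorem2p4:
  fixes A :: "'b::unital_cstar_algebra ^ 'm" and n :: nat
  assumes "n \<ge> 1" and "CARD('m) = n + 1"
  shows "\<forall>D \<in> components (proj_resolvent A). domain_of_holomorphy D"
proof
  fix D assume D: "D \<in> components (proj_resolvent A)"
  have DP: "D \<subseteq> proj_resolvent A" by (rule in_components_subset[OF D])
  have opD: "open D" using open_components[OF open_proj_resolvent D] .
  have False if VW: "open V" "open W" "V \<noteq> {}" "V \<subseteq> W \<inter> D" "connected W" "\<not> W \<subseteq> D"
    and ext: "\<forall>f. holomorphic_several_on f D \<longrightarrow>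
      (\<exists>g. holomorphic_several_on g W \<and> (\<forall>z\<in>V. f z = g z))" for V W
  proof -
    obtain v where v: "v \<in> V" using VW(3) by blast
    \<comment> \<open>Since \<open>W \<inter> D\<close> may be disconnected, agreement on
      \<open>V\<close> spreads only over a component that meets \<open>V\<close>.\<close>
    obtain U where U: "U \<in> components (W \<inter> D)" "v \<in> U"
      using v VW(4) by (metis UnionE Union_components subsetD)
    have opU: "open U" using open_components[OF open_Int[OF VW(2) opD] U(1)] .
    have conU: "connected U" using U(1) by (rule in_components_connected)
    have sub: "U \<subseteq> W" "U \<subseteq> D" using in_components_subset[OF U(1)] by auto
    obtain p where p: "p \<in> W" "p \<in> closure U" "p \<notin> proj_resolvent A"
      using component_Int_boundary_point[OF open_proj_resolvent D VW(2,5,6) U(1)] .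
    obtain z where z: "\<And>k. z k \<in> U" "z \<longlonglongrightarrow> p"
      using p(2) unfolding closure_sequential by blast
    let ?R = "\<lambda>z. inv_elem (linear_pencil A z)"
    have "(\<lambda>k. linear_pencil A (z k)) \<longlonglongrightarrow> linear_pencil A p"
      using bounded_linear.tendsto[OF bounded_linear_linear_pencil z(2)] .
    then have "\<not> bounded (range (\<lambda>k. ?R (z k)))"
      by (rule not_bounded_inv_elem) (use z(1) sub(2) DP p(3) in \<open>auto simp flip: proj_resolvent_iff\<close>)
    moreover have "bounded (u ` range (\<lambda>k. ?R (z k)))" for u :: "'b \<Rightarrow>\<^sub>L real"
    proof -
      let ?f = "\<lambda>z. Complex (u (?R z)) (- u (\<i> *\<^sub>C ?R z))"
      have f: "holomorphic_several_on ?f D"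
        using holomorphic_several_functional_resolvent DP by (rule holomorphic_several_on_subset)
      then obtain g where g: "holomorphic_several_on g W" "\<And>z. z \<in> V \<Longrightarrow> ?f z = g z"
        using ext by blast
      \<comment> \<open>The identity theorem starts from \<open>V \<inter> U\<close>, as
        \<open>V\<close> itself may reach into other components. This set is nonempty because it
        contains \<open>v\<close>.\<close>
      have "?f z = g z" if "z \<in> U" for z
        by (rule holomorphic_several_identity[of ?f U g "V \<inter> U"])
           (use f g sub opU conU v U(2) VW(1) that holomorphic_several_on_subset in auto)
      then have "u (?R (z k)) = Re (g (z k))" for k
        using z(1) by (metis complex.sel(1))
      \<comment> \<open>The extension \<open>g\<close> is continuous at \<open>p\<close>, a point of
        \<open>W\<close>, so it controls \<open>u\<close> of the inverses along the sequence
        although \<open>linear_pencil A p\<close> has no inverse.\<close>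
      moreover have "(\<lambda>k. Re (g (z k))) \<longlonglongrightarrow> Re (g p)"
        using isCont_tendsto_compose[OF holomorphic_several_on_isCont[OF g(1) p(1)] z(2)]
        by (rule tendsto_Re)
      ultimately have "convergent (\<lambda>k. u (?R (z k)))" by (auto simp: convergent_def)
      then show ?thesis using convergent_imp_bounded by (simp add: image_image convergent_def) blast
    qed
    ultimately show False using bounded_if_weakly_bounded by blast
  qed
  then show "domain_of_holomorphy D"
    unfolding domain_of_holomorphy_def
    using opD in_components_connected[OF D] in_components_nonempty[OF D] by blast
qed

end
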